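(* If a real number $\lambda$ is an eigenvalue of infinite multiplicity for at least one self-adjoint operator $H$ from the affine space $\mathcal A=H_0+\mathcal A_0(F)$, then $\lambda$ is not an essentially regular point of the pair $(\mathcal A,F)$, that is, $\lambda\notin\Lambda(\mathcal A,F)$.
   Context: Setting. $\mathcal H,\mathcal K$ are complex separable Hilbert spaces. $F:\mathcal H\to\mathcal K$ is a closed densely defined operator with trivial kernel and co-kernel (the rigging operator). $\mathcal A_0(F)$ is a real vector space of self-adjoint operators $V$ on $\mathcal H$ of the form $V=F^*JF$, where $J$ runs over a real subspace of the bounded self-adjoint operators on $\mathcal K$, and $\mathcal A=H_0+\mathcal A_0(F)$ is an affine space of self-adjoint operators on $\mathcal H$. Write $R_z(H)=(H-z)^{-1}$. Standing assumptions: all $H\in\mathcal A$ have a common dense domain $\mathcal D$; $\mathcal D\subset\operatorname{dom}(F)$ and $\mathcal D\subset\operatorname{dom}(V)$ for all $V\in\mathcal A_0(F)$; every $V\in\mathcal A_0(F)$ is relatively compact with respect to every $H\in\mathcal A$; and for non-real $z$ the operator $T_z(H):=FR_z(H)F^*$ (densely defined on $\operatorname{dom}F^*$) extends to a compact operator on $\mathcal K$, also denoted $T_z(H)$. $\Lambda(H,F)$ is the set of real $\lambda$ for which the norm limit $T_{\lambda+i0}(H):=\lim_{y\to0^+}T_{\lambda+iy}(H)$ exists; it is assumed to have full Lebesgue measure for every $H\in\mathcal A$. $\Lambda(\mathcal A,F):=\bigcup_{H\in\mathcal A}\Lambda(H,F)$; its elements are called essentially regular points of the pair $(\mathcal A,F)$.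 *)

theory Defs
  imports "HOL-Analysis.Analysis"
begin

section \<open>Complex Hilbert spaces\<close>

text \<open>The inner product is conjugate-linear in the first and linear in the second argument.
  Positive definiteness is contained in \<open>cinner_self\<close>, since \<open>norm\<close> is a norm.\<close>

class chilbert_space = banach +
  fixes scaleC :: "complex \<Rightarrow> 'a \<Rightarrow> 'a" (infixr "*\<^sub>C" 75)
    and cinner :: "'a \<Rightarrow> 'a \<Rightarrow> complex"
  assumes scaleC_add_right: "c *\<^sub>C (x + y) = c *\<^sub>C x + c *\<^sub>C y"
    and scaleC_add_left: "(c + d) *\<^sub>C x = c *\<^sub>C x + d *\<^sub>C x"
    and scaleC_scaleC: "c *\<^sub>C d *\<^sub>C x = (c * d) *\<^sub>C x"
    and scaleC_of_real: "complex_of_real r *\<^sub>C x = r *\<^sub>R x"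
    and cinner_add_right: "cinner x (y + z) = cinner x y + cinner x z"
    and cinner_scaleC_right: "cinner x (c *\<^sub>C y) = c * cinner x y"
    and cinner_commute: "cinner x y = cnj (cinner y x)"
    and cinner_self: "cinner x x = complex_of_real ((norm x)\<^sup>2)"

instantiation complex :: chilbert_space
begin
definition "scaleC c x = c * x" for c x :: complex
definition "cinner x y = cnj x * y" for x y :: complex
instance
  by standard
    (simp_all add: scaleC_complex_def cinner_complex_def algebra_simps scaleR_conv_of_real
      complex_norm_square[symmetric] del: of_real_power)
end

section \<open>Unbounded operators\<close>

text \<open>A (not necessarily everywhere defined) operator is represented by its graph. Thus equality
  of sets is equality of operators including domains, \<open>\<subseteq>\<close> is the extension relation, \<open>Domain\<close>
  is the domain, and the product $BA$ (first $A$, then $B$), on its natural domain, is \<open>A O B\<close>.\<close>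

definition linear_operator :: "('a::chilbert_space \<times> 'b::chilbert_space) set \<Rightarrow> bool" where
  "linear_operator T \<longleftrightarrow> single_valued T \<and> (0, 0) \<in> T \<and>
     (\<forall>x y x' y'. (x, y) \<in> T \<longrightarrow> (x', y') \<in> T \<longrightarrow> (x + x', y + y') \<in> T) \<and>
     (\<forall>c x y. (x, y) \<in> T \<longrightarrow> (c *\<^sub>C x, c *\<^sub>C y) \<in> T)"

definition densely_defined :: "('a::chilbert_space \<times> 'b::chilbert_space) set \<Rightarrow> bool" where
  "densely_defined T \<longleftrightarrow> closure (Domain T) = UNIV"

definition ker :: "('a::chilbert_space \<times> 'b::chilbert_space) set \<Rightarrow> 'a set" where
  "ker T = {x. (x, 0) \<in> T}"

definition adjoint_op ::
    "('a::chilbert_space \<times> 'b::chilbert_space) set \<Rightarrow> ('b \<times> 'a) set" where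
  "adjoint_op T = {(y, z). \<forall>(x, w) \<in> T. cinner y w = cinner z x}"

definition selfadjoint :: "('a::chilbert_space \<times> 'a) set \<Rightarrow> bool" where
  "selfadjoint T \<longleftrightarrow> linear_operator T \<and> densely_defined T \<and> adjoint_op T = T"

definition sum_op :: "('a::chilbert_space \<times> 'b::chilbert_space) set \<Rightarrow> ('a \<times> 'b) set
    \<Rightarrow> ('a \<times> 'b) set" where
  "sum_op S T = {(x, y + z) | x y z. (x, y) \<in> S \<and> (x, z) \<in> T}"

definition restrict_op :: "('a::chilbert_space \<times> 'b::chilbert_space) set \<Rightarrow> 'a set
    \<Rightarrow> ('a \<times> 'b) set" where
  "restrict_op T X = {(x, y) \<in> T. x \<in> X}"

text \<open>The relation $(H - z)^{-1}$.\<close>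

definition resolvent :: "complex \<Rightarrow> ('a::chilbert_space \<times> 'a) set \<Rightarrow> ('a \<times> 'a) set" where
  "resolvent z H = {(y - z *\<^sub>C x, x) | x y. (x, y) \<in> H}"

definition graph_of :: "('a::chilbert_space \<Rightarrow>\<^sub>L 'b::chilbert_space) \<Rightarrow> ('a \<times> 'b) set" where
  "graph_of T = {(x, blinfun_apply T x) | x. True}"

text \<open>Elements of \<open>'a \<Rightarrow>\<^sub>L 'b\<close> are only real-linear, so complex homogeneity is required here.\<close>

definition compact_operator :: "('a::chilbert_space \<Rightarrow>\<^sub>L 'b::chilbert_space) \<Rightarrow> bool" where
  "compact_operator T \<longleftrightarrow>
     (\<forall>c x. blinfun_apply T (c *\<^sub>C x) = c *\<^sub>C blinfun_apply T x) \<and>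
     compact (closure (blinfun_apply T ` cball 0 1))"

text \<open>$V (H - z)^{-1}$ is compact and everywhere defined for some non-real \<open>z\<close>; for self-adjoint
  \<open>H\<close> it is then so for every non-real \<open>z\<close>, by the resolvent identity.\<close>

definition relatively_compact ::
    "('a::chilbert_space \<times> 'a) set \<Rightarrow> ('a \<times> 'a) set \<Rightarrow> bool" where
  "relatively_compact V H \<longleftrightarrow> Domain H \<subseteq> Domain V \<and>
     (\<exists>z T. Im z \<noteq> 0 \<and> compact_operator T \<and> resolvent z H O V = graph_of T)"

definition eigenspace :: "('a::chilbert_space \<times> 'a) set \<Rightarrow> complex \<Rightarrow> 'a set" where
  "eigenspace H c = {x. (x, c *\<^sub>C x) \<in> H}"

definition infinite_multiplicity :: "('a::chilbert_space \<times> 'a) set \<Rightarrow> complex \<Rightarrow> bool" where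
  "infinite_multiplicity H c \<longleftrightarrow>
     \<not> (\<exists>B. finite B \<and> eigenspace H c \<subseteq> module.span (*\<^sub>C) B)"

section \<open>Rigged affine spaces of self-adjoint operators\<close>

definition sandwiched_resolvent :: "('h::chilbert_space \<times> 'k::chilbert_space) set
    \<Rightarrow> ('h \<times> 'h) set \<Rightarrow> complex \<Rightarrow> ('k \<times> 'k) set" where
  "sandwiched_resolvent F H z = adjoint_op F O resolvent z H O F"

text \<open>The compact extension of $F R_z(H) F^*$. Under the standing assumptions below it exists,
  and it is unique because the domain of $F^*$ is dense and $D \subseteq {\rm dom}\, F$.\<close>

definition T_op :: "('h::chilbert_space \<times> 'k::chilbert_space) set
    \<Rightarrow> ('h \<times> 'h) set \<Rightarrow> complex \<Rightarrow> 'k \<Rightarrow>\<^sub>L 'k" where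
  "T_op F H z = (SOME T. compact_operator T \<and> sandwiched_resolvent F H z \<subseteq> graph_of T)"

text \<open>The limit is taken in the operator norm, which is the norm of \<open>'k \<Rightarrow>\<^sub>L 'k\<close>.\<close>

definition regular_points :: "('h::chilbert_space \<times> 'k::chilbert_space) set
    \<Rightarrow> ('h \<times> 'h) set \<Rightarrow> real set" where
  "regular_points F H =
     {l. \<exists>L. ((\<lambda>y. T_op F H (Complex l y)) \<longlongrightarrow> L) (at_right 0)}"

definition essentially_regular_points :: "('h::chilbert_space \<times> 'k::chilbert_space) set
    \<Rightarrow> ('h \<times> 'h) set set \<Rightarrow> real set" where
  "essentially_regular_points F \<A> = (\<Union>H\<in>\<A>. regular_points F H)"

text \<open>The meaning of $V = F^* J F$ for a self-adjoint \<open>V\<close>: the natural domain of the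
  product $F^* J F$ is contained in the domain of \<open>F\<close>, and on the domain of \<open>F\<close> the operators \<open>V\<close>
  and $F^* J F$ coincide, domains included. Literal equality implies this. It is not demanded,
  since for $J = 0$ it would say that the zero operator on the domain of \<open>F\<close> is self-adjoint,
  i.e. that \<open>F\<close> is everywhere defined and hence bounded.\<close>

definition rigged_form :: "('h::chilbert_space \<times> 'k::chilbert_space) set
    \<Rightarrow> ('k \<Rightarrow>\<^sub>L 'k) \<Rightarrow> ('h \<times> 'h) set \<Rightarrow> bool" where
  "rigged_form F J V \<longleftrightarrow> restrict_op V (Domain F) = F O graph_of J O adjoint_op F"

definition affine_space_of :: "('h::chilbert_space \<times> 'h) set \<Rightarrow> ('h \<times> 'h) set set
    \<Rightarrow> ('h \<times> 'h) set set" where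
  "affine_space_of H0 \<A>0 = sum_op H0 ` \<A>0"

text \<open>\<open>\<J>\<close> is the real vector space through which \<open>\<A>0\<close> is parametrised. The linear structure of
  \<open>\<A>0\<close> is that of \<open>\<J>\<close>; on the common domain \<open>D\<close> it is the pointwise one.\<close>

locale rigged_affine_space =
  fixes F :: "('h::chilbert_space \<times> 'k::chilbert_space) set"
    and \<J> :: "('k \<Rightarrow>\<^sub>L 'k) set"
    and \<A>0 :: "('h \<times> 'h) set set"
    and H0 :: "('h \<times> 'h) set"
    and D :: "'h set"
  assumes separable_H: "separable_space (euclidean :: 'h topology)"
    and separable_K: "separable_space (euclidean :: 'k topology)"
    and F_operator: "linear_operator F"
    and F_closed: "closed F"
    and F_dense: "densely_defined F"
    and F_kernel: "ker F = {0}"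
    and F_cokernel: "ker (adjoint_op F) = {0}"
    and J_subspace: "subspace \<J>"
    and J_selfadjoint: "J \<in> \<J> \<Longrightarrow> selfadjoint (graph_of J)"
    and V_selfadjoint: "V \<in> \<A>0 \<Longrightarrow> selfadjoint V"
    and V_form: "V \<in> \<A>0 \<Longrightarrow> \<exists>J\<in>\<J>. rigged_form F J V"
    and J_form: "J \<in> \<J> \<Longrightarrow> \<exists>V\<in>\<A>0. rigged_form F J V"
    and H_selfadjoint: "H \<in> affine_space_of H0 \<A>0 \<Longrightarrow> selfadjoint H"
    and H_domain: "H \<in> affine_space_of H0 \<A>0 \<Longrightarrow> Domain H = D"
    and D_dense: "closure D = UNIV"
    and D_F: "D \<subseteq> Domain F"
    and D_V: "V \<in> \<A>0 \<Longrightarrow> D \<subseteq> Domain V"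
    and V_relatively_compact:
      "V \<in> \<A>0 \<Longrightarrow> H \<in> affine_space_of H0 \<A>0 \<Longrightarrow> relatively_compact V H"
    and compact_extension:
      "H \<in> affine_space_of H0 \<A>0 \<Longrightarrow> Im z \<noteq> 0 \<Longrightarrow>
         \<exists>T. compact_operator T \<and> sandwiched_resolvent F H z \<subseteq> graph_of T"
    and regular_full_measure:
      "H \<in> affine_space_of H0 \<A>0 \<Longrightarrow> - regular_points F H \<in> null_sets lebesgue"

end

theory Submission
  imports Defs
begin

text \<open>Let $\lambda$ be a regular point of \<open>H'\<close>, let $H = H' + F^* J F$ on the common domain, let
  $H\chi = \lambda\chi$ and $z = \lambda + iy$. Then $(H' - z)\chi = -F^* J F \chi - iy\chi$, hence
  $(1 + T_z(H') J) F\chi = -iy F R_z(H') \chi$. Paired with a vector \<open>g\<close> of the dense domain of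
  $F^*$ the right-hand side tends to 0 as $y \to 0^+$, because
  $y \|R_{\bar z}(H') F^* g\|^2 \le \|T_z(H')\| \|g\|^2$. So \<open>F\<close> maps the eigenspace injectively
  into the kernel of $1 + T_{\lambda + i0}(H') J$, which is finite-dimensional since
  $T_{\lambda + i0}(H')$ is a norm limit of compact operators.\<close>

section \<open>Geometry of complex Hilbert spaces\<close>

lemma additive_cinner: "Modules.additive (cinner x)" for x :: "'a::chilbert_space"
  by (simp add: Modules.additive_def cinner_add_right)

lemmas cinner_zero_right [simp] = Modules.additive.zero[OF additive_cinner]
  and cinner_minus_right = Modules.additive.minus[OF additive_cinner]
  and cinner_diff_right = Modules.additive.diff[OF additive_cinner]

lemma cinner_add_left: "cinner (x + y) z = cinner x z + cinner y z"
  for x y z :: "'a::chilbert_space"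
  by (metis cinner_commute cinner_add_right complex_cnj_add)

lemma cinner_scaleC_left: "cinner (c *\<^sub>C x) y = cnj c * cinner x y"
  for x y :: "'a::chilbert_space"
  by (metis cinner_commute cinner_scaleC_right complex_cnj_mult)

lemma cinner_zero_left [simp]: "cinner 0 x = 0" for x :: "'a::chilbert_space"
  by (metis cinner_commute cinner_zero_right complex_cnj_zero)

lemma cinner_diff_left: "cinner (x - y) z = cinner x z - cinner y z"
  for x y z :: "'a::chilbert_space"
  by (metis cinner_commute cinner_diff_right complex_cnj_diff)

lemma cinner_eq_zero_commute: "cinner x y = 0 \<longleftrightarrow> cinner y x = 0"
  for x y :: "'a::chilbert_space"
  by (metis cinner_commute complex_cnj_zero_iff)

lemma cinner_self_eq_zero [simp]: "cinner x x = 0 \<longleftrightarrow> x = 0" for x :: "'a::chilbert_space"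
  by (simp add: cinner_self)

text \<open>Supplies subspaces and spans over the complex scalars; \<open>cvec.span\<close> is the
  \<open>module.span\<close> used to define infinite multiplicity.\<close>

interpretation cvec: vector_space "(*\<^sub>C) :: complex \<Rightarrow> 'a \<Rightarrow> 'a::chilbert_space"
proof
  show "1 *\<^sub>C x = x" for x :: 'a
    using scaleC_of_real[of 1 x] by simp
qed (simp_all add: scaleC_add_right scaleC_add_left scaleC_scaleC)

lemma power2_norm_add:
  "(norm (x + y))\<^sup>2 = (norm x)\<^sup>2 + 2 * Re (cinner x y) + (norm y)\<^sup>2"
  for x y :: "'a::chilbert_space"
proof -
  have "complex_of_real ((norm (x + y))\<^sup>2) = cinner x x + (cinner x y + cnj (cinner x y)) + cinner y y"
    unfolding cinner_self[symmetric] using cinner_commute[of y x]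
    by (simp add: cinner_add_left cinner_add_right)
  also have "\<dots> = complex_of_real ((norm x)\<^sup>2 + 2 * Re (cinner x y) + (norm y)\<^sup>2)"
    by (simp add: cinner_self complex_add_cnj)
  finally show ?thesis
    using of_real_eq_iff by blast
qed

lemma power2_norm_diff:
  "(norm (x - y))\<^sup>2 = (norm x)\<^sup>2 - 2 * Re (cinner x y) + (norm y)\<^sup>2"
  for x y :: "'a::chilbert_space"
  using power2_norm_add[of x "- y"] by (simp add: cinner_minus_right)

lemma norm_scaleC: "norm (c *\<^sub>C x) = cmod c * norm x" for x :: "'a::chilbert_space"
proof (rule power2_eq_imp_eq)
  have "cinner (c *\<^sub>C x) (c *\<^sub>C x) = (c * cnj c) * cinner x x"
    by (simp add: cinner_scaleC_right cinner_scaleC_left)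
  then have "complex_of_real ((norm (c *\<^sub>C x))\<^sup>2) = complex_of_real ((cmod c * norm x)\<^sup>2)"
    by (simp only: cinner_self complex_norm_square[symmetric] power_mult_distrib of_real_mult)
  then show "(norm (c *\<^sub>C x))\<^sup>2 = (cmod c * norm x)\<^sup>2"
    by (simp only: of_real_eq_iff)
qed simp_all

text \<open>Pythagoras for \<open>p\<close> split along \<open>x\<close>. Nonnegativity of the
  residual gives Cauchy-Schwarz; in the projection theorem a nonzero inner product would shorten a
  minimal distance.\<close>

lemma power2_norm_diff_projection:
  fixes x p :: "'a::chilbert_space"
  assumes "x \<noteq> 0"
  shows "(norm (p - (cinner x p / cinner x x) *\<^sub>C x))\<^sup>2 = (norm p)\<^sup>2 - (cmod (cinner x p) / norm x)\<^sup>2"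
proof -
  define c where "c = cinner x p / cinner x x"
  define q where "q = p - c *\<^sub>C x"
  have "cinner x q = 0"
    using assms by (simp add: q_def c_def cinner_diff_right cinner_scaleC_right)
  then have "cinner q (c *\<^sub>C x) = 0"
    by (simp add: cinner_scaleC_right cinner_eq_zero_commute[of q])
  then have "(norm p)\<^sup>2 = (norm q)\<^sup>2 + (norm (c *\<^sub>C x))\<^sup>2"
    using power2_norm_add[of q "c *\<^sub>C x"] by (simp add: q_def)
  moreover have "cmod c * norm x = cmod (cinner x p) / norm x"
    using assms by (simp add: c_def cinner_self norm_divide norm_mult power2_eq_square)
  ultimately show ?thesis
    by (simp add: q_def c_def norm_scaleC)
qed

lemma cmod_cinner_le: "cmod (cinner x y) \<le> norm x * norm y"
  for x y :: "'a::chilbert_space"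
proof (cases "x = 0")
  case False
  have "(cmod (cinner x y) / norm x)\<^sup>2 \<le> (norm y)\<^sup>2"
    using power2_norm_diff_projection[OF False, of y]
      zero_le_power2[of "norm (y - (cinner x y / cinner x x) *\<^sub>C x)"] by linarith
  then have "cmod (cinner x y) / norm x \<le> norm y"
    by (rule power2_le_imp_le) simp
  then show ?thesis
    using False by (simp add: divide_le_eq mult.commute)
qed simp

lemma bounded_bilinear_cinner:
  "bounded_bilinear (cinner :: 'a::chilbert_space \<Rightarrow> 'a \<Rightarrow> complex)"
proof
  show "cinner (r *\<^sub>R a) b = r *\<^sub>R cinner a b" for r and a b :: 'a
    using cinner_scaleC_left[of "complex_of_real r" a b]
    by (simp add: scaleC_of_real scaleR_conv_of_real)
  show "cinner a (r *\<^sub>R b) = r *\<^sub>R cinner a b" for r and a b :: 'a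
    using cinner_scaleC_right[of a "complex_of_real r" b]
    by (simp add: scaleC_of_real scaleR_conv_of_real)
  show "\<exists>K. \<forall>(a::'a) b. cmod (cinner a b) \<le> norm a * norm b * K"
    by (intro exI[of _ 1]) (simp add: cmod_cinner_le)
qed (simp_all add: cinner_add_left cinner_add_right)

lemmas tendsto_cinner = bounded_bilinear.tendsto[OF bounded_bilinear_cinner]
lemmas continuous_on_cinner [continuous_intros] =
  bounded_bilinear.continuous_on[OF bounded_bilinear_cinner]

lemma bounded_linear_scaleC: "bounded_linear ((*\<^sub>C) c :: 'a \<Rightarrow> 'a::chilbert_space)"
proof
  show "c *\<^sub>C (r *\<^sub>R x) = r *\<^sub>R (c *\<^sub>C x)" for r and x :: 'a
    unfolding scaleC_of_real[symmetric] by (simp add: scaleC_scaleC mult.commute)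
  show "\<exists>K. \<forall>x::'a. norm (c *\<^sub>C x) \<le> norm x * K"
    by (intro exI[of _ "cmod c"]) (simp add: norm_scaleC)
qed (simp add: scaleC_add_right)

section \<open>Orthogonal projections and a compactness criterion for finite dimension\<close>

text \<open>The minimising sequence is Cauchy by the parallelogram law.\<close>

lemma orthogonal_projection_exists:
  fixes M :: "'a::chilbert_space set"
  assumes "closed M" and M: "cvec.subspace M"
  obtains m where "m \<in> M" "\<And>x. x \<in> M \<Longrightarrow> cinner x (p - m) = 0"
proof -
  have ne: "M \<noteq> {}"
    using M cvec.subspace_0 by blast
  define d where "d = infdist p M"
  have d_le: "d \<le> norm (p - x)" if "x \<in> M" for x
    using infdist_le[OF that, of p] by (simp add: d_def dist_norm)
  have d0: "0 \<le> d"
    by (simp add: d_def infdist_nonneg)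
  have "\<exists>x\<in>M. norm (p - x) < d + inverse (real (Suc n))" for n
  proof -
    have "Inf (dist p ` M) < d + inverse (real (Suc n))"
      using ne by (simp add: d_def infdist_def)
    then show ?thesis
      using cInf_lessD[of "dist p ` M"] ne by (auto simp: dist_norm)
  qed
  then obtain s where s: "\<And>n. s n \<in> M" "\<And>n. norm (p - s n) < d + inverse (real (Suc n))"
    by metis
  have lim: "(\<lambda>n. norm (p - s n)) \<longlonglongrightarrow> d"
  proof (rule tendsto_sandwich)
    show "\<forall>\<^sub>F n in sequentially. d \<le> norm (p - s n)"
      using d_le s(1) by simp
    show "\<forall>\<^sub>F n in sequentially. norm (p - s n) \<le> d + inverse (real (Suc n))"
      using less_imp_le[OF s(2)] by (rule always_eventually[OF allI])
    show "(\<lambda>n. d + inverse (real (Suc n))) \<longlonglongrightarrow> d"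
      using tendsto_add[OF tendsto_const LIMSEQ_inverse_real_of_nat, of d] by simp
  qed simp
  have par: "(norm (s i - s j))\<^sup>2 \<le> 2 * ((norm (p - s i))\<^sup>2 - d\<^sup>2) + 2 * ((norm (p - s j))\<^sup>2 - d\<^sup>2)"
    for i j
  proof -
    \<comment> \<open>The midpoint stays in \<open>M\<close>, so its distance from \<open>p\<close>
      is at least \<open>d\<close>; the parallelogram law turns this into the bound.\<close>
    have "(1/2) *\<^sub>R (s i + s j) \<in> M"
      using cvec.subspace_scale[OF M cvec.subspace_add[OF M s(1) s(1)], of "complex_of_real (1/2)" i j]
      by (simp only: scaleC_of_real)
    then have "d\<^sup>2 \<le> (norm (p - (1/2) *\<^sub>R (s i + s j)))\<^sup>2"
      using d_le d0 power_mono by blast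
    moreover have "(p - s i) + (p - s j) = 2 *\<^sub>R (p - (1/2) *\<^sub>R (s i + s j))"
      by (simp add: algebra_simps scaleR_2)
    then have "(norm ((p - s i) + (p - s j)))\<^sup>2 = 4 * (norm (p - (1/2) *\<^sub>R (s i + s j)))\<^sup>2"
      by (simp add: power_mult_distrib)
    moreover have "(p - s j) - (p - s i) = s i - s j"
      by simp
    ultimately show ?thesis
      using power2_norm_add[of "p - s j" "p - s i"] power2_norm_diff[of "p - s j" "p - s i"]
      by (simp add: add.commute)
  qed
  have "Cauchy s"
  proof (rule metric_CauchyI)
    fix e :: real
    assume e: "0 < e"
    \<comment> \<open>With the factor 4, each of the two terms in \<open>par\<close> stays below
      half of the square of \<open>e\<close>.\<close>
    have "(\<lambda>n. 4 * ((norm (p - s n))\<^sup>2 - d\<^sup>2)) \<longlonglongrightarrow> 4 * (d\<^sup>2 - d\<^sup>2)"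
      by (intro tendsto_intros lim)
    then have "\<forall>\<^sub>F n in sequentially. 4 * ((norm (p - s n))\<^sup>2 - d\<^sup>2) < e\<^sup>2"
      using e by (intro order_tendstoD(2)) auto
    then obtain N where N: "\<And>n. n \<ge> N \<Longrightarrow> 4 * ((norm (p - s n))\<^sup>2 - d\<^sup>2) < e\<^sup>2"
      by (auto simp: eventually_sequentially)
    have "dist (s i) (s j) < e" if "i \<ge> N" "j \<ge> N" for i j
    proof -
      have "(norm (s i - s j))\<^sup>2 < e\<^sup>2"
        using par[of i j] N[OF that(1)] N[OF that(2)] by linarith
      then show ?thesis
        using e by (simp add: dist_norm power2_less_imp_less)
    qed
    then show "\<exists>N. \<forall>i\<ge>N. \<forall>j\<ge>N. dist (s i) (s j) < e"
      by blast
  qed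
  then obtain m where m: "s \<longlonglongrightarrow> m"
    using Cauchy_convergent convergent_def by blast
  have mM: "m \<in> M"
    using assms(1) s(1) m closed_sequentially by blast
  have norm_m: "norm (p - m) = d"
    by (rule LIMSEQ_unique[OF _ lim]) (intro tendsto_intros m)
  have "cinner x (p - m) = 0" if x: "x \<in> M" for x
  proof (cases "x = 0")
    case False
    \<comment> \<open>Moving from \<open>m\<close> by the best multiple of \<open>x\<close> would
      bring the distance below \<open>d\<close> unless the inner product vanishes.\<close>
    define c where "c = cinner x (p - m) / cinner x x"
    have "m + c *\<^sub>C x \<in> M"
      using M mM x by (simp add: cvec.subspace_add cvec.subspace_scale)
    then have "d \<le> norm (p - m - c *\<^sub>C x)"
      using d_le by (fastforce simp: diff_diff_eq)
    then have "d\<^sup>2 \<le> (norm (p - m - c *\<^sub>C x))\<^sup>2"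
      using d0 power_mono by blast
    then have "(cmod (cinner x (p - m)) / norm x)\<^sup>2 \<le> 0"
      using power2_norm_diff_projection[OF False, of "p - m"] by (simp add: c_def norm_m)
    then show ?thesis
      using False by simp
  qed simp
  with mM show thesis
    by (rule that)
qed

text \<open>Gram-Schmidt by induction: the hypothesis is applied to the new vector \<open>b\<close>
  as well as to \<open>x\<close>, and the projection of \<open>x\<close> is then corrected along the
  part of \<open>b\<close> orthogonal to the old span.\<close>

lemma finite_span_orthogonal_projection:
  fixes B :: "'a::chilbert_space set"
  assumes "finite B"
  shows "\<exists>m\<in>cvec.span B. \<forall>b\<in>B. cinner b (x - m) = 0"
  using assms
proof (induction B arbitrary: x)
  case empty
  then show ?case
    by (auto intro: cvec.span_zero)
next
  case (insert b B)
  obtain mb where mb: "mb \<in> cvec.span B" "\<And>a. a \<in> B \<Longrightarrow> cinner a (b - mb) = 0"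
    using insert.IH by blast
  obtain mx where mx: "mx \<in> cvec.span B" "\<And>a. a \<in> B \<Longrightarrow> cinner a (x - mx) = 0"
    using insert.IH by blast
  have sub: "cvec.span B \<subseteq> cvec.span (insert b B)"
    by (rule cvec.span_mono) blast
  define v where "v = b - mb"
  \<comment> \<open>If \<open>b\<close> already lies in the old span, \<open>v\<close> may be 0;
    division by zero then gives \<open>c = 0\<close>, and no correction is made.\<close>
  define c where "c = cinner v (x - mx) / cinner v v"
  define m where "m = mx + c *\<^sub>C v"
  have v_span: "v \<in> cvec.span (insert b B)"
    unfolding v_def using mb(1) sub by (blast intro: cvec.span_diff cvec.span_base)
  have "m \<in> cvec.span (insert b B)"
    unfolding m_def using mx(1) sub v_span by (blast intro: cvec.span_add cvec.span_scale)
  moreover have B: "cinner a (x - m) = 0" if "a \<in> B" for a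
    using mx(2)[OF that] mb(2)[OF that]
    by (simp add: m_def v_def[symmetric] diff_diff_eq[symmetric] cinner_diff_right[of a "x - mx"]
        cinner_scaleC_right)
  moreover have "cinner b (x - m) = 0"
  proof -
    have "cinner (x - m) a = 0" if "a \<in> cvec.span B" for a
      using that
    proof (induction rule: cvec.span_induct_alt)
      case (step k a' y)
      then show ?case
        using B cinner_eq_zero_commute by (auto simp: cinner_add_right cinner_scaleC_right)
    qed simp
    then have "cinner mb (x - m) = 0"
      using mb(1) cinner_eq_zero_commute by blast
    moreover have "cinner v (x - m) = 0"
      by (cases "v = 0") (simp_all add: m_def diff_diff_eq[symmetric]
          cinner_diff_right[of v "x - mx"] cinner_scaleC_right c_def)
    moreover have "b = v + mb"
      by (simp add: v_def)
    ultimately show ?thesis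
      by (simp add: cinner_add_left)
  qed
  ultimately show ?case
    by blast
qed

text \<open>A unit vector orthogonal to all centres of a net of mesh 1 would not be covered by the net.\<close>

lemma finite_span_if_unit_ball_near_compact:
  fixes S K :: "'a::chilbert_space set"
  assumes S: "cvec.subspace S" and K: "compact K"
    and near: "\<And>u. u \<in> S \<Longrightarrow> norm u \<le> 1 \<Longrightarrow> \<exists>k\<in>K. dist u k < 1/4"
  obtains B where "finite B" "B \<subseteq> S" "S \<subseteq> cvec.span B"
proof -
  obtain C where C: "finite C" "K \<subseteq> (\<Union>c\<in>C. ball c (1/4))"
  proof (rule compactE_image[OF K])
    show "K \<subseteq> (\<Union>c\<in>K. ball c (1/4))"
      by force
  qed (use that in auto)
  \<comment> \<open>The centres lie in \<open>K\<close>, not necessarily in \<open>S\<close>. A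
    point of \<open>S\<close> replaces each useful centre: radii 1/4 + 1/4 give 1/2, and two halves
    give the mesh 1.\<close>
  define pick where "pick c = (SOME u. u \<in> S \<and> dist u c < 1/2)" for c
  define B where "B = pick ` {c\<in>C. \<exists>u\<in>S. dist u c < 1/2}"
  have pick: "pick c \<in> S" "dist (pick c) c < 1/2" if "\<exists>u\<in>S. dist u c < 1/2" for c
    using someI_ex[of "\<lambda>u. u \<in> S \<and> dist u c < 1/2"] that by (auto simp: pick_def)
  have cover: "\<exists>b\<in>B. dist u b < 1" if u: "u \<in> S" "norm u \<le> 1" for u
  proof -
    obtain k where k: "k \<in> K" "dist u k < 1/4"
      using near u by blast
    then obtain c where c: "c \<in> C" "dist c k < 1/4"
      using C(2) by auto
    then have uc: "dist u c < 1/2"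
      using k dist_triangle_half_r[of k u "1/2" c] by (simp add: dist_commute)
    then have "pick c \<in> B" "dist (pick c) c < 1/2"
      using c u pick by (auto simp: B_def)
    then show ?thesis
      using uc dist_triangle_half_r[of c u 1 "pick c"] by (auto simp: dist_commute)
  qed
  have finB: "finite B" and BS: "B \<subseteq> S"
    using C(1) pick by (auto simp: B_def)
  have "x \<in> cvec.span B" if x: "x \<in> S" for x
  proof -
    obtain m where m: "m \<in> cvec.span B" "\<And>b. b \<in> B \<Longrightarrow> cinner b (x - m) = 0"
      using finite_span_orthogonal_projection[OF finB] by blast
    define v where "v = complex_of_real (inverse (norm (x - m))) *\<^sub>C (x - m)"
    have "m \<in> S"
      using cvec.span_minimal[OF BS S] m(1) by blast
    then have vS: "v \<in> S"
      unfolding v_def using S x by (intro cvec.subspace_scale cvec.subspace_diff)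
    have "x = m"
    proof (rule ccontr)
      assume "x \<noteq> m"
      then have v1: "norm v = 1"
        unfolding v_def scaleC_of_real by simp
      then obtain b where b: "b \<in> B" "dist v b < 1"
        using cover[OF vS] by auto
      have "cinner b v = 0"
        using m(2)[OF b(1)] by (simp add: v_def cinner_scaleC_right)
      then have "(norm (b - v))\<^sup>2 = (norm b)\<^sup>2 + 1"
        using v1 by (simp add: power2_norm_diff)
      moreover have "(norm (b - v))\<^sup>2 < 1"
        using b(2) by (simp add: dist_norm norm_minus_commute power_less_one_iff)
      ultimately show False
        using zero_le_power2[of "norm b"] by linarith
    qed
    with m(1) show ?thesis
      by simp
  qed
  then show thesis
    using that finB BS by blast
qed

text \<open>The direct sum of Hilbert spaces contains the graphs of operators, so a closed operator
  becomes a closed subspace onto which one can project.\<close>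

instantiation prod :: (chilbert_space, chilbert_space) chilbert_space
begin
definition "scaleC c x = (c *\<^sub>C fst x, c *\<^sub>C snd x)" for c and x :: "'a \<times> 'b"
definition "cinner x y = cinner (fst x) (fst y) + cinner (snd x) (snd y)" for x y :: "'a \<times> 'b"
instance
proof
  fix x y :: "'a \<times> 'b"
  show "cinner x y = cnj (cinner y x)"
    using cinner_commute[of "fst x" "fst y"] cinner_commute[of "snd x" "snd y"]
    by (simp add: cinner_prod_def)
qed (simp_all add: scaleC_prod_def cinner_prod_def scaleC_add_right scaleC_add_left scaleC_scaleC
    scaleC_of_real cinner_add_right cinner_scaleC_right cinner_self algebra_simps prod_eq_iff
    norm_prod_def del: of_real_power flip: of_real_add)
end

section \<open>Unbounded operators\<close>

lemma linear_operator_add: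
  "linear_operator T \<Longrightarrow> (x, y) \<in> T \<Longrightarrow> (x', y') \<in> T \<Longrightarrow> (x + x', y + y') \<in> T"
  by (simp add: linear_operator_def)

lemma linear_operator_scale: "linear_operator T \<Longrightarrow> (x, y) \<in> T \<Longrightarrow> (c *\<^sub>C x, c *\<^sub>C y) \<in> T"
  by (simp add: linear_operator_def)

lemma linear_operator_diff:
  "linear_operator T \<Longrightarrow> (x, y) \<in> T \<Longrightarrow> (x', y') \<in> T \<Longrightarrow> (x - x', y - y') \<in> T"
  using linear_operator_add[of T x y "- x'" "- y'"] linear_operator_scale[of T x' y' "-1"] by simp

lemma linear_operator_unique: "linear_operator T \<Longrightarrow> (x, y) \<in> T \<Longrightarrow> (x, y') \<in> T \<Longrightarrow> y = y'"
  by (auto simp: linear_operator_def single_valued_def)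

lemma linear_operator_zero: "linear_operator T \<Longrightarrow> (0, 0) \<in> T"
  by (simp add: linear_operator_def)

lemma adjoint_opD: "(y, z) \<in> adjoint_op T \<Longrightarrow> (x, w) \<in> T \<Longrightarrow> cinner y w = cinner z x"
  by (auto simp: adjoint_op_def)

lemma adjoint_op_diff:
  "(y, z) \<in> adjoint_op T \<Longrightarrow> (y', z') \<in> adjoint_op T \<Longrightarrow> (y - y', z - z') \<in> adjoint_op T"
  by (fastforce simp: adjoint_op_def cinner_diff_left)

text \<open>Each element of the graph imposes one closed condition. Self-adjoint operators are
  closed because they equal their adjoints.\<close>

lemma closed_adjoint_op: "closed (adjoint_op T)"
proof -
  have "adjoint_op T = (\<Inter>(x, w)\<in>T. {p. cinner (fst p) w = cinner (snd p) x})"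
    by (auto simp: adjoint_op_def)
  also have "closed \<dots>"
    by (auto intro!: closed_INT closed_Collect_eq continuous_intros)
  finally show ?thesis .
qed

text \<open>By closedness the double orthogonal complement of the graph is the graph, so that a vector
  \<open>(0, k)\<close> with \<open>k\<close> orthogonal to the domain of the adjoint lies in the graph.\<close>

lemma orthogonal_Domain_adjoint_eq_zero:
  fixes F :: "('h::chilbert_space \<times> 'k::chilbert_space) set"
  assumes F: "linear_operator F" "closed F"
    and orth: "\<And>g. g \<in> Domain (adjoint_op F) \<Longrightarrow> cinner g k = 0"
  shows "k = 0"
proof -
  have "cvec.subspace F"
    using F(1) by (auto simp: cvec.subspace_def scaleC_prod_def zero_prod_def
        intro: linear_operator_add linear_operator_scale linear_operator_zero)
  from orthogonal_projection_exists[OF F(2) this, of "(0, k)"]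
  obtain m where "m \<in> F" and perp: "\<And>p. p \<in> F \<Longrightarrow> cinner p ((0, k) - m) = 0"
    by blast
  then obtain x y where m: "m = (x, y)" and xy: "(x, y) \<in> F"
    by (cases m) auto
  have "cinner b (k - y) = cinner a x" if "(a, b) \<in> F" for a b
    using perp[OF that] by (simp add: m cinner_prod_def cinner_minus_right)
  \<comment> \<open>Orthogonality of the residual \<open>(- x, k - y)\<close> to the graph is the
    adjoint relation, up to conjugation.\<close>
  then have adj: "(k - y, x) \<in> adjoint_op F"
    using cinner_commute[of "k - y"] cinner_commute[of x] by (auto simp: adjoint_op_def)
  have "cinner (k - y) k = 0"
    using orth adj by blast
  \<comment> \<open>Split the second \<open>k\<close> as \<open>(k - y) + y\<close>; the adjoint
    relation at \<open>(x, y)\<close> turns the pairing with \<open>y\<close> into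
    \<open>cinner x x\<close>.\<close>
  then have "cinner (k - y) (k - y) + cinner x x = 0"
    using adjoint_opD[OF adj xy] by (simp add: cinner_diff_right[of _ k y])
  then have "complex_of_real ((norm (k - y))\<^sup>2 + (norm x)\<^sup>2) = 0"
    by (simp add: cinner_self)
  then have "(norm (k - y))\<^sup>2 + (norm x)\<^sup>2 = 0"
    by (simp only: of_real_eq_0_iff)
  then have "k = y" "x = 0"
    by simp_all
  then show ?thesis
    using xy linear_operator_unique[OF F(1)] linear_operator_zero[OF F(1)] by blast
qed

section \<open>Resolvents of self-adjoint operators at non-real points\<close>

lemma selfadjoint_symmetric:
  assumes "selfadjoint H" "(x, a) \<in> H" "(y, b) \<in> H"
  shows "cinner x b = cinner a y"
  using assms adjoint_opD[of x a H y b] by (simp add: selfadjoint_def)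

text \<open>Membership of \<open>(x, h + z *\<^sub>C x)\<close> encodes
  \<open>(H - z) x = h\<close>, the form in which resolvents appear from here on. The pairing of
  \<open>x\<close> with \<open>H x\<close> is real, so only \<open>z\<close> contributes to the
  imaginary part.\<close>

lemma selfadjoint_Im_cinner:
  assumes "selfadjoint H" "(x, h + z *\<^sub>C x) \<in> H"
  shows "Im (cinner x h) = - Im z * (norm x)\<^sup>2"
proof -
  have "cinner x (h + z *\<^sub>C x) = cnj (cinner x (h + z *\<^sub>C x))"
    unfolding cinner_commute[symmetric] by (rule selfadjoint_symmetric[OF assms(1,2,2)])
  then have "Im (cinner x (h + z *\<^sub>C x)) = 0"
    by (simp add: complex_eq_iff)
  then show ?thesis
    by (simp add: cinner_add_right cinner_scaleC_right cinner_self del: of_real_power)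
qed

text \<open>Cauchy-Schwarz applied to the imaginary part; this is the resolvent bound by the inverse
  of \<open>\<bar>Im z\<bar>\<close>.\<close>

lemma selfadjoint_lower_bound:
  assumes "selfadjoint H" "(x, h + z *\<^sub>C x) \<in> H"
  shows "\<bar>Im z\<bar> * norm x \<le> norm h"
proof (cases "x = 0")
  case False
  have "\<bar>Im z\<bar> * (norm x)\<^sup>2 = \<bar>Im (cinner x h)\<bar>"
    using selfadjoint_Im_cinner[OF assms] by (simp add: abs_mult)
  also have "\<dots> \<le> norm x * norm h"
    using abs_Im_le_cmod cmod_cinner_le order_trans by blast
  finally show ?thesis
    using False by (simp add: power2_eq_square)
qed simp

text \<open>The range of \<open>H - z\<close> is closed by the lower bound. A vector orthogonal to
  it is an eigenvector of the adjoint, hence of \<open>H\<close>, for \<open>cnj z\<close>, and the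
  lower bound at \<open>cnj z\<close> makes it zero.\<close>

lemma selfadjoint_range:
  fixes H :: "('h::chilbert_space \<times> 'h) set"
  assumes H: "selfadjoint H" and z: "Im z \<noteq> 0"
  shows "\<exists>x. (x, h + z *\<^sub>C x) \<in> H"
proof -
  have lin: "linear_operator H" and adj: "adjoint_op H = H"
    using H by (auto simp: selfadjoint_def)
  define M where "M = {h. \<exists>x. (x, h + z *\<^sub>C x) \<in> H}"
  have sub: "cvec.subspace M"
    unfolding cvec.subspace_def
  proof (intro conjI ballI allI)
    show "0 \<in> M"
      using linear_operator_zero[OF lin] by (auto simp: M_def intro!: exI[of _ 0])
    show "h + k \<in> M" if hk: "h \<in> M" "k \<in> M" for h k
    proof -
      obtain x y where "(x, h + z *\<^sub>C x) \<in> H" "(y, k + z *\<^sub>C y) \<in> H"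
        using hk by (auto simp: M_def)
      from linear_operator_add[OF lin this] show ?thesis
        by (auto simp: M_def scaleC_add_right algebra_simps intro!: exI[of _ "x + y"])
    qed
    show "c *\<^sub>C h \<in> M" if h: "h \<in> M" for c h
    proof -
      obtain x where "(x, h + z *\<^sub>C x) \<in> H"
        using h by (auto simp: M_def)
      from linear_operator_scale[OF lin this, of c] show ?thesis
        by (auto simp: M_def scaleC_add_right scaleC_scaleC mult.commute intro!: exI[of _ "c *\<^sub>C x"])
    qed
  qed
  have "closed M"
    unfolding closed_sequential_limits
  proof (intro allI impI, elim conjE)
    fix s l
    assume s: "\<forall>n. s n \<in> M" and l: "s \<longlonglongrightarrow> l"
    then obtain x where x: "\<And>n. (x n, s n + z *\<^sub>C x n) \<in> H"
      unfolding M_def by (simp, metis)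
    have est: "\<bar>Im z\<bar> * norm (x i - x j) \<le> norm (s i - s j)" for i j
    proof (rule selfadjoint_lower_bound[OF H])
      show "(x i - x j, s i - s j + z *\<^sub>C (x i - x j)) \<in> H"
        using linear_operator_diff[OF lin x[of i] x[of j]]
        by (simp add: cvec.scale_right_diff_distrib algebra_simps)
    qed
    have "Cauchy x"
    proof (rule metric_CauchyI)
      fix e :: real
      assume e: "0 < e"
      have "Cauchy s"
        using l by (rule LIMSEQ_imp_Cauchy)
      moreover have "0 < \<bar>Im z\<bar> * e"
        using z e by simp
      ultimately obtain N where N: "\<And>i j. i \<ge> N \<Longrightarrow> j \<ge> N \<Longrightarrow> dist (s i) (s j) < \<bar>Im z\<bar> * e"
        by (meson Cauchy_def)
      have "dist (x i) (x j) < e" if "i \<ge> N" "j \<ge> N" for i j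
      proof -
        have "\<bar>Im z\<bar> * dist (x i) (x j) < \<bar>Im z\<bar> * e"
          using N[OF that] est[of i j] by (simp add: dist_norm)
        then show ?thesis
          using z by (simp add: mult_less_cancel_left_pos)
      qed
      then show "\<exists>N. \<forall>i\<ge>N. \<forall>j\<ge>N. dist (x i) (x j) < e"
        by blast
    qed
    then obtain y where y: "x \<longlonglongrightarrow> y"
      using Cauchy_convergent convergent_def by blast
    have "(\<lambda>n. (x n, s n + z *\<^sub>C x n)) \<longlonglongrightarrow> (y, l + z *\<^sub>C y)"
      by (intro tendsto_Pair tendsto_add y l bounded_linear.tendsto[OF bounded_linear_scaleC])
    then have "(y, l + z *\<^sub>C y) \<in> H"
      using closed_sequentially[OF closed_adjoint_op[of H, unfolded adj], of "\<lambda>n. (x n, s n + z *\<^sub>C x n)"] x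
      by blast
    then show "l \<in> M"
      by (auto simp: M_def)
  qed
  from orthogonal_projection_exists[OF this sub, of h]
  obtain m where m: "m \<in> M" "\<And>k. k \<in> M \<Longrightarrow> cinner k (h - m) = 0"
    by blast
  define v where "v = h - m"
  have "cinner v b = cinner (cnj z *\<^sub>C v) a" if "(a, b) \<in> H" for a b
  proof -
    have "b - z *\<^sub>C a \<in> M"
      using that by (auto simp: M_def intro!: exI[of _ a])
    then have "cinner v (b - z *\<^sub>C a) = 0"
      using m(2) cinner_eq_zero_commute by (auto simp: v_def)
    then show ?thesis
      by (simp add: cinner_diff_right cinner_scaleC_right cinner_scaleC_left)
  qed
  then have "(v, 0 + cnj z *\<^sub>C v) \<in> adjoint_op H"
    by (auto simp: adjoint_op_def)
  then have "\<bar>Im z\<bar> * norm v \<le> 0"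
    using selfadjoint_lower_bound[OF H, of v 0 "cnj z"] adj by simp
  then have "v = 0"
    using z by (simp add: mult_le_0_iff)
  then show ?thesis
    using m(1) by (auto simp: M_def v_def)
qed

section \<open>Eigenspaces and their images under an injective operator\<close>

lemma subspace_eigenspace:
  assumes "linear_operator H"
  shows "cvec.subspace (eigenspace H c)"
  unfolding cvec.subspace_def eigenspace_def mem_Collect_eq
proof (intro conjI ballI allI)
  show "(0, c *\<^sub>C 0) \<in> H"
    using linear_operator_zero[OF assms] by simp
  show "(x + y, c *\<^sub>C (x + y)) \<in> H"
    if "x \<in> {x. (x, c *\<^sub>C x) \<in> H}" "y \<in> {x. (x, c *\<^sub>C x) \<in> H}" for x y
    using that linear_operator_add[OF assms] by (simp add: scaleC_add_right)
  show "(d *\<^sub>C x, c *\<^sub>C d *\<^sub>C x) \<in> H" if "x \<in> {x. (x, c *\<^sub>C x) \<in> H}" for d x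
    using that linear_operator_scale[OF assms, of x "c *\<^sub>C x" d]
    by (simp add: scaleC_scaleC mult.commute)
qed

lemma subspace_Image:
  assumes F: "linear_operator F" and E: "cvec.subspace E"
  shows "cvec.subspace (F `` E)"
  unfolding cvec.subspace_def
proof (intro conjI ballI allI)
  show "0 \<in> F `` E"
    using linear_operator_zero[OF F] cvec.subspace_0[OF E] by (rule ImageI)
  show "x + y \<in> F `` E" if "x \<in> F `` E" "y \<in> F `` E" for x y
    using that by (elim ImageE) (rule ImageI[OF linear_operator_add[OF F] cvec.subspace_add[OF E]])
  show "c *\<^sub>C x \<in> F `` E" if "x \<in> F `` E" for c x
    using that by (elim ImageE) (rule ImageI[OF linear_operator_scale[OF F] cvec.subspace_scale[OF E]])
qed

text \<open>Preimages of the spanning vectors span \<open>E\<close>: two preimages of one vector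
  differ by an element of the trivial kernel.\<close>

lemma finite_span_if_finite_span_Image:
  fixes F :: "('h::chilbert_space \<times> 'k::chilbert_space) set"
  assumes F: "linear_operator F" and ker: "ker F = {0}" and dom: "E \<subseteq> Domain F"
    and B: "finite B" "B \<subseteq> F `` E" "F `` E \<subseteq> cvec.span B"
  shows "\<exists>A. finite A \<and> E \<subseteq> cvec.span A"
proof -
  obtain e where e: "\<And>b. b \<in> B \<Longrightarrow> (e b, b) \<in> F"
    using B(2) bchoice[of B "\<lambda>b x. (x, b) \<in> F"] by blast
  have lift: "\<exists>x\<in>cvec.span (e ` B). (x, y) \<in> F" if "y \<in> cvec.span B" for y
    using that
  proof (induction rule: cvec.span_induct_alt)
    case base
    then show ?case
      using linear_operator_zero[OF F] cvec.span_zero by blast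
  next
    case (step c b y)
    then obtain x where "x \<in> cvec.span (e ` B)" "(x, y) \<in> F"
      by blast
    with step(1) have "c *\<^sub>C e b + x \<in> cvec.span (e ` B)" "(c *\<^sub>C e b + x, c *\<^sub>C b + y) \<in> F"
      using e F by (auto intro: cvec.span_add cvec.span_scale cvec.span_base
          linear_operator_add linear_operator_scale)
    then show ?case
      by blast
  qed
  have "x \<in> cvec.span (e ` B)" if "x \<in> E" for x
  proof -
    obtain y where y: "(x, y) \<in> F"
      using dom \<open>x \<in> E\<close> by blast
    then obtain x' where x': "x' \<in> cvec.span (e ` B)" "(x', y) \<in> F"
      using lift B(3) \<open>x \<in> E\<close> by blast
    have "x - x' \<in> ker F"
      using linear_operator_diff[OF F y x'(2)] by (simp add: ker_def)
    with ker x'(1) show ?thesis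
      by simp
  qed
  with B(1) show ?thesis
    by blast
qed

section \<open>Eigenvectors at an essentially regular point\<close>

context rigged_affine_space
begin

section \<open>The sandwiched resolvent and differences within the affine space\<close>

lemma T_op_spec:
  assumes "H \<in> affine_space_of H0 \<A>0" "Im z \<noteq> 0"
  shows "compact_operator (T_op F H z)" "sandwiched_resolvent F H z \<subseteq> graph_of (T_op F H z)"
  unfolding T_op_def using someI_ex[OF compact_extension[OF assms]] by auto

text \<open>On the domain of the adjoint every admissible extension has the same value, so the
  choice in \<open>T_op\<close> is harmless there. Here \<open>v\<close> is the resolvent applied to
  \<open>p\<close>.\<close>

lemma T_op_apply:
  assumes "H \<in> affine_space_of H0 \<A>0" "Im z \<noteq> 0"
    and "(g, p) \<in> adjoint_op F" "(v, p + z *\<^sub>C v) \<in> H" "(v, f) \<in> F"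
  shows "T_op F H z g = f"
proof -
  have "(p, v) \<in> resolvent z H"
    using assms(4) by (force simp: resolvent_def)
  then have "(g, f) \<in> sandwiched_resolvent F H z"
    using assms(3,5) by (auto simp: sandwiched_resolvent_def)
  then show ?thesis
    using T_op_spec(2)[OF assms(1,2)] by (auto simp: graph_of_def)
qed

lemma obtain_resolvent:
  assumes "H \<in> affine_space_of H0 \<A>0" "Im z \<noteq> 0"
  obtains v f where "(v, p + z *\<^sub>C v) \<in> H" "(v, f) \<in> F"
proof -
  obtain v where v: "(v, p + z *\<^sub>C v) \<in> H"
    using selfadjoint_range[OF H_selfadjoint[OF assms(1)] assms(2)] by blast
  then have "v \<in> Domain F"
    using H_domain[OF assms(1)] D_F by blast
  with v that show thesis
    by blast
qed

text \<open>Both operators share the summand \<open>H0\<close>, so it cancels and the difference of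
  the two bounded middle factors serves as \<open>J\<close>.\<close>

lemma difference_form:
  assumes H: "H \<in> affine_space_of H0 \<A>0" and H': "H' \<in> affine_space_of H0 \<A>0"
  obtains J where "\<And>x h u. (x, h) \<in> H \<Longrightarrow> (x, u) \<in> F \<Longrightarrow>
    \<exists>q. (blinfun_apply J u, q) \<in> adjoint_op F \<and> (x, h - q) \<in> H'"
proof -
  obtain V V' where V: "V \<in> \<A>0" "H = sum_op H0 V" and V': "V' \<in> \<A>0" "H' = sum_op H0 V'"
    using H H' by (auto simp: affine_space_of_def)
  obtain J J' where J: "rigged_form F J V" and J': "rigged_form F J' V'"
    using V_form V(1) V'(1) by blast
  \<comment> \<open>\<open>rigged_form\<close> describes \<open>W\<close> on the domain of
    \<open>F\<close> only; the pair \<open>(x, u)\<close> places \<open>x\<close> there.\<close>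
  have form: "(blinfun_apply K u, b) \<in> adjoint_op F"
    if "rigged_form F K W" "(x, u) \<in> F" "(x, b) \<in> W" for K W x u b
  proof -
    have "(x, b) \<in> F O graph_of K O adjoint_op F"
      using that by (auto simp: rigged_form_def restrict_op_def)
    then show ?thesis
      using linear_operator_unique[OF F_operator that(2)] by (auto simp: graph_of_def)
  qed
  have "\<exists>q. (blinfun_apply (J - J') u, q) \<in> adjoint_op F \<and> (x, h - q) \<in> H'"
    if x: "(x, h) \<in> H" "(x, u) \<in> F" for x h u
  proof -
    obtain a b where ab: "h = a + b" "(x, a) \<in> H0" "(x, b) \<in> V"
      using x(1) V(2) by (auto simp: sum_op_def)
    obtain c where c: "(x, c) \<in> V'"
      using x(1) H_domain[OF H] D_V[OF V'(1)] by blast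
    have "(blinfun_apply (J - J') u, b - c) \<in> adjoint_op F"
      using adjoint_op_diff[OF form[OF J x(2) ab(3)] form[OF J' x(2) c]]
      by (simp add: blinfun.diff_left)
    moreover have "(x, a + c) \<in> H'"
      using ab(2) c V'(2) by (auto simp: sum_op_def)
    ultimately show ?thesis
      using ab(1) by (intro exI[of _ "b - c"]) simp
  qed
  then show thesis
    by (rule that)
qed

text \<open>Here $w = R_{\bar z}(H) F^* g$. The imaginary part of $\langle w, F^* g\rangle$ naturally
  produces $T_{\bar z}$, which self-adjointness of \<open>H\<close> trades for $T_z$.\<close>

lemma conjugate_resolvent_bound:
  assumes H: "H \<in> affine_space_of H0 \<A>0" and z: "Im z > 0"
    and g: "(g, p) \<in> adjoint_op F" and w: "(w, p + cnj z *\<^sub>C w) \<in> H"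
  shows "Im z * (norm w)\<^sup>2 \<le> norm (T_op F H z) * (norm g)\<^sup>2"
proof -
  have sa: "selfadjoint H"
    using H by (rule H_selfadjoint)
  obtain v f where v: "(v, p + z *\<^sub>C v) \<in> H" "(v, f) \<in> F"
    using obtain_resolvent[OF H] z by (metis less_irrefl)
  \<comment> \<open>Symmetry of \<open>H\<close>; the terms in \<open>z\<close> agree on both sides
    and cancel, which exchanges the resolvent at \<open>cnj z\<close> for the one at
    \<open>z\<close>.\<close>
  have "cinner w (p + z *\<^sub>C v) = cinner (p + cnj z *\<^sub>C w) v"
    using selfadjoint_symmetric[OF sa w v(1)] .
  then have "cinner w p = cinner p v"
    by (simp add: cinner_add_right cinner_add_left cinner_scaleC_left cinner_scaleC_right)
  also have "\<dots> = cinner g (T_op F H z g)"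
    using adjoint_opD[OF g v(2)] T_op_apply[OF H _ g v] z by simp
  finally have "Im z * (norm w)\<^sup>2 = Im (cinner g (T_op F H z g))"
    using selfadjoint_Im_cinner[OF sa w] by simp
  also have "\<dots> \<le> norm g * norm (T_op F H z g)"
    using abs_Im_le_cmod[of "cinner g (T_op F H z g)"] cmod_cinner_le[of g "T_op F H z g"] by linarith
  also have "\<dots> \<le> norm g * (norm (T_op F H z) * norm g)"
    by (intro mult_left_mono norm_blinfun) simp
  finally show ?thesis
    by (simp add: power2_eq_square algebra_simps)
qed

text \<open>In the application \<open>j\<close> and \<open>q\<close> are \<open>J F x\<close> and
  \<open>F^* J F x\<close>, and this \<open>H\<close> is the operator at which \<open>l\<close> is
  regular, so that \<open>x\<close> is an eigenvector of the other operator.\<close>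

lemma regularized_eigenvector_equation:
  assumes H: "H \<in> affine_space_of H0 \<A>0" and y: "y > 0"
    and u: "(x, u) \<in> F" and j: "(j, q) \<in> adjoint_op F"
    and x: "(x, complex_of_real l *\<^sub>C x - q) \<in> H"
    and g: "(g, p) \<in> adjoint_op F"
  shows "cmod (cinner g (u + T_op F H (Complex l y) j))
    \<le> sqrt y * (sqrt (norm (T_op F H (Complex l y))) * norm g * norm x)"
proof -
  define z where "z = Complex l y"
  have z: "Im z > 0" "Im z \<noteq> 0" "Im (cnj z) \<noteq> 0" "Im z = y"
    using y by (simp_all add: z_def)
  have sa: "selfadjoint H" and lin: "linear_operator H"
    using H_selfadjoint[OF H] by (auto simp: selfadjoint_def)
  obtain v f where v: "(v, q + z *\<^sub>C v) \<in> H" "(v, f) \<in> F"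
    using obtain_resolvent[OF H z(2)] .
  obtain w where w: "(w, p + cnj z *\<^sub>C w) \<in> H"
    using selfadjoint_range[OF sa z(3)] by blast
  have Tj: "T_op F H z j = f"
    using T_op_apply[OF H z(2) j v] .
  \<comment> \<open>This split turns the sum of the relations for \<open>x\<close> and
    \<open>v\<close> into \<open>(H - z)(x + v) = - \<i> y x\<close>.\<close>
  have "complex_of_real l = z + (- \<i> * y)"
    by (simp add: z_def complex_eq_iff)
  then have "complex_of_real l *\<^sub>C x - q + (q + z *\<^sub>C v) = (- \<i> * y) *\<^sub>C x + z *\<^sub>C (x + v)"
    by (simp only: scaleC_add_left scaleC_add_right) simp
  then have "(x + v, (- \<i> * y) *\<^sub>C x + z *\<^sub>C (x + v)) \<in> H"
    using linear_operator_add[OF lin x v(1)] by simp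
  \<comment> \<open>Pairing with \<open>w\<close> transfers the resolvent to the side of
    \<open>p\<close>, and the terms in \<open>z\<close> cancel again.\<close>
  from selfadjoint_symmetric[OF sa w this]
  have "cinner p (x + v) = cinner w ((- \<i> * y) *\<^sub>C x)"
    by (simp add: cinner_add_right[of w _ "z *\<^sub>C (x + v)"] cinner_scaleC_right[of w z]
        cinner_add_left[of p] cinner_scaleC_left del: cvec.scale_minus_left)
  moreover have "cinner g (u + f) = cinner p (x + v)"
    using adjoint_opD[OF g linear_operator_add[OF F_operator u v(2)]] .
  ultimately have "cmod (cinner g (u + T_op F H z j)) = y * cmod (cinner w x)"
    using y by (simp add: Tj cinner_scaleC_right norm_mult del: cvec.scale_minus_left)
  also have "\<dots> \<le> y * (norm w * norm x)"
    using y cmod_cinner_le by (intro mult_left_mono) auto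
  \<comment> \<open>Of the two factors \<open>sqrt y\<close>, one is absorbed by the resolvent
    bound; the other survives and tends to 0.\<close>
  also have "y * norm w \<le> sqrt y * (sqrt (norm (T_op F H z)) * norm g)"
  proof -
    have "y * (norm w)\<^sup>2 \<le> norm (T_op F H z) * (norm g)\<^sup>2"
      using conjugate_resolvent_bound[OF H z(1) g w] z(4) by simp
    then have "sqrt (y * (norm w)\<^sup>2) \<le> sqrt (norm (T_op F H z) * (norm g)\<^sup>2)"
      by (rule real_sqrt_le_mono)
    then have "sqrt y * (sqrt y * norm w) \<le> sqrt y * (sqrt (norm (T_op F H z)) * norm g)"
      using y by (intro mult_left_mono) (auto simp: real_sqrt_mult)
    then show ?thesis
      using y by (simp flip: mult.assoc)
  qed
  then have "y * (norm w * norm x) \<le> sqrt y * (sqrt (norm (T_op F H z)) * norm g * norm x)"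
    using mult_right_mono[of "y * norm w" "sqrt y * (sqrt (norm (T_op F H z)) * norm g)" "norm x"]
    by (simp add: mult.assoc)
  finally show ?thesis
    by (simp add: z_def)
qed

text \<open>The norms of \<open>T_op\<close> converge, so the previous bound vanishes in the limit.
  The equation is thus obtained weakly against the domain of the adjoint, which is enough by
  density.\<close>

lemma limit_eigenvector_equation:
  assumes H: "H \<in> affine_space_of H0 \<A>0"
    and L: "((\<lambda>y. T_op F H (Complex l y)) \<longlongrightarrow> L) (at_right 0)"
    and u: "(x, u) \<in> F" and j: "(j, q) \<in> adjoint_op F"
    and x: "(x, complex_of_real l *\<^sub>C x - q) \<in> H"
  shows "u + blinfun_apply L j = 0"
proof (rule orthogonal_Domain_adjoint_eq_zero[OF F_operator F_closed])
  fix g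
  assume "g \<in> Domain (adjoint_op F)"
  then obtain p where g: "(g, p) \<in> adjoint_op F"
    by blast
  let ?T = "\<lambda>y. T_op F H (Complex l y)"
  have "((\<lambda>y. sqrt y * (sqrt (norm (?T y)) * norm g * norm x))
      \<longlongrightarrow> sqrt 0 * (sqrt (norm L) * norm g * norm x)) (at_right 0)"
    by (intro tendsto_intros L)
  then have lim: "((\<lambda>y. sqrt y * (sqrt (norm (?T y)) * norm g * norm x)) \<longlongrightarrow> 0) (at_right 0)"
    by simp
  have "((\<lambda>y. cinner g (u + ?T y j)) \<longlongrightarrow> 0) (at_right 0)"
    using eventually_at_right_less[of "0::real"]
    by (intro Lim_null_comparison[OF _ lim], elim eventually_mono)
      (rule regularized_eigenvector_equation[OF H _ u j x g])
  moreover have "((\<lambda>y. cinner g (u + ?T y j)) \<longlongrightarrow> cinner g (u + blinfun_apply L j)) (at_right 0)"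
    by (intro tendsto_cinner tendsto_add tendsto_const blinfun.tendsto L)
  ultimately show "cinner g (u + blinfun_apply L j) = 0"
    by (rule tendsto_unique[OF trivial_limit_at_right_real, symmetric])
qed

text \<open>On the image of the eigenspace \<open>u = - L (J u)\<close>, and \<open>L\<close> is
  close to a compact \<open>T\<close> at a single small \<open>y\<close>. Hence the unit ball of
  that image lies near a compact set.\<close>

lemma finite_multiplicity_at_regular_point:
  assumes H: "H \<in> affine_space_of H0 \<A>0" and H': "H' \<in> affine_space_of H0 \<A>0"
    and l: "l \<in> regular_points F H'"
  shows "\<not> infinite_multiplicity H (complex_of_real l)"
proof -
  let ?E = "eigenspace H (complex_of_real l)"
  have E: "cvec.subspace ?E"
    using H_selfadjoint[OF H] subspace_eigenspace unfolding selfadjoint_def by blast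
  have EF: "?E \<subseteq> Domain F"
    using H_domain[OF H] D_F unfolding eigenspace_def by blast
  obtain L where L: "((\<lambda>y. T_op F H' (Complex l y)) \<longlongrightarrow> L) (at_right 0)"
    using l by (auto simp: regular_points_def)
  obtain J where J: "\<And>x h u. (x, h) \<in> H \<Longrightarrow> (x, u) \<in> F \<Longrightarrow>
      \<exists>q. (blinfun_apply J u, q) \<in> adjoint_op F \<and> (x, h - q) \<in> H'"
    using difference_form[OF H H'] by blast
  have fixpoint: "u + L (J u) = 0" if "u \<in> F `` ?E" for u
    using that J limit_eigenvector_equation[OF H' L] by (fastforce simp: eigenspace_def)
  \<comment> \<open>Adding 1 keeps \<open>r\<close> positive even for \<open>J = 0\<close>, so that
    dividing by \<open>r\<close> is safe.\<close>
  define r where "r = norm J + 1"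
  have r: "r > 0" "norm J \<le> r"
    by (simp_all add: r_def add_nonneg_pos)
  \<comment> \<open>Vectors \<open>J u\<close> have norm at most \<open>r\<close>, so this tolerance
    yields the distance 1/4 of the compactness criterion.\<close>
  have "\<forall>\<^sub>F y in at_right 0. dist (T_op F H' (Complex l y)) L < 1 / (4 * r) \<and> y > 0"
    using L r by (intro eventually_conj tendstoD eventually_at_right_less) auto
  then obtain y where y: "y > 0" "dist (T_op F H' (Complex l y)) L < 1 / (4 * r)"
    using eventually_happens'[of "at_right (0::real)"] by auto
  define T where "T = T_op F H' (Complex l y)"
  define K where "K = (\<lambda>k. (- r) *\<^sub>R k) ` closure (T ` cball 0 1)"
  have "compact_operator T"
    using T_op_spec(1)[OF H'] y by (simp add: T_def)
  then have K: "compact K"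
    unfolding K_def by (intro compact_scaling) (simp add: compact_operator_def)
  have near: "\<exists>k\<in>K. dist u k < 1/4" if u: "u \<in> F `` ?E" "norm u \<le> 1" for u
  proof (rule bexI[of _ "- T (J u)"])
    have Ju: "norm (J u) \<le> r"
      using norm_blinfun[of J u] r u(2) mult_mono[of "norm J" r "norm u" 1] by simp
    then have "(1 / r) *\<^sub>R J u \<in> cball 0 1"
      using r by simp
    then have "T ((1 / r) *\<^sub>R J u) \<in> closure (T ` cball 0 1)"
      by (intro subsetD[OF closure_subset] imageI)
    then have "(- r) *\<^sub>R T ((1 / r) *\<^sub>R J u) \<in> K"
      unfolding K_def by (rule imageI)
    moreover have "(- r) *\<^sub>R T ((1 / r) *\<^sub>R J u) = - T (J u)"
      using r(1) by (simp add: blinfun.scaleR_right)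
    ultimately show "- T (J u) \<in> K"
      by (simp only:)
    \<comment> \<open>The second summand is zero by \<open>fixpoint\<close>, so the distance is
      controlled by \<open>T - L\<close> alone.\<close>
    have "u - - T (J u) = (T - L) (J u) + (u + L (J u))"
      by (simp add: blinfun.diff_left)
    then have "u - - T (J u) = (T - L) (J u)"
      unfolding fixpoint[OF u(1)] by simp
    then have "dist u (- T (J u)) \<le> norm (T - L) * norm (J u)"
      using norm_blinfun[of "T - L" "J u"] by (simp add: dist_norm)
    also have "\<dots> \<le> norm (T - L) * r"
      using Ju by (intro mult_left_mono) auto
    also have "\<dots> < 1/4"
      using y(2) r by (simp add: T_def dist_norm field_simps)
    finally show "dist u (- T (J u)) < 1/4" .
  qed
  obtain B where "finite B" "B \<subseteq> F `` ?E" "F `` ?E \<subseteq> cvec.span B"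
    using finite_span_if_unit_ball_near_compact[OF subspace_Image[OF F_operator E] K near] .
  from finite_span_if_finite_span_Image[OF F_operator F_kernel EF this] show ?thesis
    by (simp add: infinite_multiplicity_def)
qed

end

theorem theorem1p24:
  fixes F :: "('h::chilbert_space \<times> 'k::chilbert_space) set"
    and \<J> :: "('k \<Rightarrow>\<^sub>L 'k) set"
    and \<A>0 :: "('h \<times> 'h) set set"
    and H0 :: "('h \<times> 'h) set"
    and D :: "'h set"
    and l :: real
  assumes "rigged_affine_space F \<J> \<A>0 H0 D"
    and "\<exists>H \<in> affine_space_of H0 \<A>0. infinite_multiplicity H (complex_of_real l)"
  shows "l \<notin> essentially_regular_points F (affine_space_of H0 \<A>0)"
proof
  assume "l \<in> essentially_regular_points F (affine_space_of H0 \<A>0)"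
  \<comment> \<open>The operator at which \<open>l\<close> is regular may differ from the one with
    the eigenvalue.\<close>
  then obtain H' where H': "H' \<in> affine_space_of H0 \<A>0" "l \<in> regular_points F H'"
    unfolding essentially_regular_points_def by (elim UN_E)
  obtain H where H: "H \<in> affine_space_of H0 \<A>0" "infinite_multiplicity H (complex_of_real l)"
    using assms(2) by (elim bexE)
  show False
    using rigged_affine_space.finite_multiplicity_at_regular_point[OF assms(1) H(1) H'] H(2)
    by (rule notE)
qed

end
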